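(* Let $\mathcal{B}\in\mathcal{L}^2$ be a single-input single-output system ($m(\mathcal{B})=p(\mathcal{B})=1$), and let $(u_d,y_d)\in\mathcal{B}_{[0,T]}$ be a data sequence. Define $$M_L:=\operatorname{im}\begin{bmatrix}\mathcal{H}_L(u_d)_{1,\ldots,l(\mathcal{B})}\\ \mathcal{H}_L(y_d)_{1,\ldots,l(\mathcal{B})}\end{bmatrix}^{\top},\quad L\ge1.$$ If there exists $L\ge l(\mathcal{B})+n(\mathcal{B})+1$ such that $\mathcal{H}_L(y_d)_i^\top\notin M_L$ for some $1\le i\le L$, then the relative degree of the system is $r(\mathcal{B})=k_y-k_u$, where $$k_u=\min\{1\le i\le L:\mathcal{H}_L(u_d)_i^\top\notin M_L\},\qquad k_y=\min\{1\le i\le L:\mathcal{H}_L(y_d)_i^\top\notin M_L\}.$$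
   Context: Discrete-time systems. $\mathcal{L}^w$ is the class of behaviors $\mathcal{B}\subseteq(\mathbb{R}^w)^{\mathbb{N}_0}$ that are linear subspaces, shift-invariant ($\sigma\mathcal{B}\subseteq\mathcal{B}$ with $(\sigma f)(t)=f(t+1)$) and closed under pointwise convergence. $\mathcal{B}_{[a,b]}$ is the set of restrictions to $\{a,\dots,b\}$ of trajectories in $\mathcal{B}$. The input cardinality $m(\mathcal{B})$ is the maximal dimension of a free subspace of signals (one whose components can follow any sequence irrespective of the past), and $p(\mathcal{B})=w-m(\mathcal{B})$. Signals are partitioned as $(u,y)$ with $u\in\mathbb{R}^{m(\mathcal{B})}$, $y\in\mathbb{R}^{p(\mathcal{B})}$. Every $\mathcal{B}\in\mathcal{L}^w$ has a state space representation $(A,B,C,D)$: $\mathcal{B}$ is the set of all $(u,y)$ for which there is a state sequence $x:\mathbb{N}_0\to\mathbb{R}^n$ with $x(t+1)=Ax(t)+Bu(t)$, $y(t)=Cx(t)+Du(t)$ for all $t\in\mathbb{N}_0$. It is minimal if $n$ is the smallest possible; this smallest $n$ is the McMillan degree $n(\mathcal{B})$. The lag $l(\mathcal{B})$ is the smallest $L\in\mathbb{N}_0$ such that, for a minimal representation, $[C^\top,(CA)^\top,\ldots,(CA^{L-1})^\top]^\top$ has rank $n(\mathcal{B})$ (independent of the minimal representation). For $f:\{0,\dots,T\}\to\mathbb{R}$ and $L\le T+1$, the Hankel matrix $\mathcal{H}_L(f)$ has $L$ rows and $T-L+2$ columns, with entry $(i,j)$ equal to $f(i+j-2)$. For a matrix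 $N$, $N_i$ is its $i$-th row and $N_{i,\ldots,j}$ the submatrix of rows $i$ through $j$. Relative degree of a SISO system with representation $(A,B,C,D)$ (independent of the representation): $r(\mathcal{B})=0$ if $D\ne0$; if $D=0$, $r(\mathcal{B})=r\ge1$ if $CA^kB=0$ for all $0\le k<r-1$ and $CA^{r-1}B\neq0$; and $r(\mathcal{B})=\infty$ if $D=0$ and $CA^{k}B=0$ for all $k\in\mathbb{N}_0$. *)

theory Defs
  imports
    "HOL-Library.Extended_Nat"
    "HOL-Library.FuncSet"
    "HOL-Analysis.Analysis"
    "Jordan_Normal_Form.Matrix"
    "Jordan_Normal_Form.DL_Rank"
begin

text \<open>
  Trajectories take values in \<open>carrier_vec w\<close>, since the numbers of signals and of states are
  quantified over.
\<close>

type_synonym traj = "nat \<Rightarrow> real vec"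

type_synonym behavior = "traj set"

definition shift :: "traj \<Rightarrow> traj"  (\<open>\<sigma>\<close>)
  where "\<sigma> f = (\<lambda>t. f (t + 1))"

definition pointwise_limit :: "nat \<Rightarrow> (nat \<Rightarrow> traj) \<Rightarrow> traj \<Rightarrow> bool"
  where "pointwise_limit w F f \<longleftrightarrow> (\<forall>t. \<forall>i<w. (\<lambda>k. F k t $ i) \<longlonglongrightarrow> f t $ i)"

definition LTI :: "nat \<Rightarrow> behavior set"  (\<open>\<L>\<close>)
  where "\<L> w = {\<B>. \<B> \<subseteq> {f. \<forall>t. f t \<in> carrier_vec w}
    \<and> (\<lambda>_. 0\<^sub>v w) \<in> \<B>
    \<and> (\<forall>f\<in>\<B>. \<forall>g\<in>\<B>. (\<lambda>t. f t + g t) \<in> \<B>)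
    \<and> (\<forall>c. \<forall>f\<in>\<B>. (\<lambda>t. c \<cdot>\<^sub>v f t) \<in> \<B>)
    \<and> \<sigma> ` \<B> \<subseteq> \<B>
    \<and> (\<forall>F f. (\<forall>k. F k \<in> \<B>) \<and> (\<forall>t. f t \<in> carrier_vec w) \<and> pointwise_limit w F f \<longrightarrow> f \<in> \<B>)}"

definition restrict_beh :: "behavior \<Rightarrow> nat \<Rightarrow> nat \<Rightarrow> traj set"
  where "restrict_beh \<B> a b = (\<lambda>f. restrict f {a..b}) ` \<B>"

text \<open>
  The signal \<open>t \<mapsto> P *\<^sub>v f t\<close>, with \<open>P\<close> of size \<open>k \<times> w\<close>, is free if after every past of a
  trajectory of the full behavior it can be continued by any sequence in \<open>k\<close>-space.
  The input cardinality is the largest rank of such a \<open>P\<close>, so that free signals need not be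
  subvectors of the given signal.
\<close>

definition free_signal :: "behavior \<Rightarrow> nat \<Rightarrow> real mat \<Rightarrow> bool"
  where "free_signal \<B> k P \<longleftrightarrow>
    (\<forall>f\<in>\<B>. \<forall>t. \<forall>v. (\<forall>s. v s \<in> carrier_vec k) \<longrightarrow>
      (\<exists>g\<in>\<B>. (\<forall>s<t. g s = f s) \<and> (\<forall>s\<ge>t. P *\<^sub>v g s = v s)))"

definition input_card :: "nat \<Rightarrow> behavior \<Rightarrow> nat"
  where "input_card w \<B> =
    Max {k. \<exists>P \<in> carrier_mat k w. vec_space.rank k P = k \<and> free_signal \<B> k P}"

definition output_card :: "nat \<Rightarrow> behavior \<Rightarrow> nat"
  where "output_card w \<B> = w - input_card w \<B>"

text \<open>
  The signal is partitioned as \<open>(u, y)\<close>: the first \<open>input_card w \<B>\<close> components are inputs,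
  i.e. form a (maximal) free signal, and the remaining ones are outputs.
\<close>

definition io_partitioned :: "nat \<Rightarrow> behavior \<Rightarrow> bool"
  where "io_partitioned w \<B> \<longleftrightarrow>
    (let m = input_card w \<B>
     in free_signal \<B> m (mat m w (\<lambda>(i, j). if i = j then 1 else 0)))"

definition ss_rep ::
    "nat \<Rightarrow> behavior \<Rightarrow> nat \<Rightarrow> real mat \<Rightarrow> real mat \<Rightarrow> real mat \<Rightarrow> real mat \<Rightarrow> bool"
  where "ss_rep w \<B> n A B C D \<longleftrightarrow>
    (let m = input_card w \<B>; p = output_card w \<B> in
      A \<in> carrier_mat n n \<and> B \<in> carrier_mat n m \<and> C \<in> carrier_mat p n \<and> D \<in> carrier_mat p m \<and>
      \<B> = {f. \<exists>u y x. (\<forall>t. u t \<in> carrier_vec m) \<and> (\<forall>t. y t \<in> carrier_vec p) \<and>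
                (\<forall>t. x t \<in> carrier_vec n) \<and> (\<forall>t. f t = u t @\<^sub>v y t) \<and>
                (\<forall>t. x (t + 1) = A *\<^sub>v x t + B *\<^sub>v u t) \<and>
                (\<forall>t. y t = C *\<^sub>v x t + D *\<^sub>v u t)})"

definition mcmillan_degree :: "nat \<Rightarrow> behavior \<Rightarrow> nat"
  where "mcmillan_degree w \<B> = (LEAST n. \<exists>A B C D. ss_rep w \<B> n A B C D)"

fun obs_mat :: "nat \<Rightarrow> real mat \<Rightarrow> real mat \<Rightarrow> real mat"
  where
    "obs_mat 0 A C = 0\<^sub>m 0 (dim_col C)"
  | "obs_mat (Suc L) A C = obs_mat L A C @\<^sub>r (C * A ^\<^sub>m L)"

text \<open>The rank below does not depend on the minimal representation that is chosen.\<close>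

definition lag :: "nat \<Rightarrow> behavior \<Rightarrow> nat"
  where "lag w \<B> =
    (LEAST L. \<exists>A B C D. ss_rep w \<B> (mcmillan_degree w \<B>) A B C D
       \<and> vec_space.rank (output_card w \<B> * L) (obs_mat L A C) = mcmillan_degree w \<B>)"

definition ss_relative_degree :: "real mat \<Rightarrow> real mat \<Rightarrow> real mat \<Rightarrow> real mat \<Rightarrow> enat"
  where "ss_relative_degree A B C D =
    (if D \<noteq> 0\<^sub>m 1 1 then 0
     else if \<forall>k. C * A ^\<^sub>m k * B = 0\<^sub>m 1 1 then \<infinity>
     else enat (THE r. r \<ge> 1 \<and> (\<forall>k<r - 1. C * A ^\<^sub>m k * B = 0\<^sub>m 1 1)
                         \<and> C * A ^\<^sub>m (r - 1) * B \<noteq> 0\<^sub>m 1 1))"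

text \<open>All representations of a single-input single-output behavior give the same value.\<close>

definition relative_degree :: "behavior \<Rightarrow> enat"
  where "relative_degree \<B> =
    (THE r. \<exists>n A B C D. ss_rep 2 \<B> n A B C D \<and> r = ss_relative_degree A B C D)"

text \<open>Matrices are indexed from 0, so \<open>row_block\<close> takes 1-based row numbers and shifts them.\<close>

definition hankel :: "nat \<Rightarrow> nat \<Rightarrow> (nat \<Rightarrow> real) \<Rightarrow> real mat"
  where "hankel T L f = mat L (T + 2 - L) (\<lambda>(i, j). f (i + j))"

definition row_block :: "real mat \<Rightarrow> nat \<Rightarrow> nat \<Rightarrow> real mat"
  where "row_block N a b = mat (b + 1 - a) (dim_col N) (\<lambda>(i, j). N $$ (a - 1 + i, j))"

definition mat_image :: "real mat \<Rightarrow> real vec set"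
  where "mat_image N = (\<lambda>v. N *\<^sub>v v) ` carrier_vec (dim_col N)"

definition data_image :: "behavior \<Rightarrow> nat \<Rightarrow> nat \<Rightarrow> (nat \<Rightarrow> real) \<Rightarrow> (nat \<Rightarrow> real) \<Rightarrow> real vec set"
  where "data_image \<B> T L u y =
    mat_image ((row_block (hankel T L u) 1 (lag 2 \<B>) @\<^sub>r
                row_block (hankel T L y) 1 (lag 2 \<B>))\<^sup>T)"

text \<open>1-based numbers of the rows of \<open>N\<close> that lie outside \<open>M\<close>.\<close>

definition rows_outside :: "real mat \<Rightarrow> real vec set \<Rightarrow> nat set"
  where "rows_outside N M = {i. 1 \<le> i \<and> i \<le> dim_row N \<and> row N (i - 1) \<notin> M}"

end

theory Submission
  imports Defs
begin

text \<open>
  Let \<open>d + 1\<close> be the length of the shortest window on which the behavior is restricted. Since the input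
  is free, the restriction determines the last output of the window, so by completeness
  \<open>\<B>\<close> is the solution set of one recurrence
  \<open>y (t + d) = (\<Sum>i<d. a i * y (t + i)) + (\<Sum>i\<le>d. b i * u (t + i))\<close>.
  The observer canonical form realizes it with \<open>d\<close> states, and both the McMillan degree and the lag
  are \<open>d\<close>. The response to an impulse preceded by \<open>d\<close> zeros shows that the relative degree is
  \<open>d - \<delta>\<close> for the largest \<open>\<delta>\<close> with \<open>b \<delta> \<noteq> 0\<close>. The rows of the Hankel matrices satisfy the same
  recurrence and the first \<open>d\<close> of each lie in \<open>M\<close>, so the first input row outside \<open>M\<close>, with number
  \<open>\<kappa>\<close>, pushes the output rows out of \<open>M\<close> exactly at \<open>\<kappa> + (d - \<delta>)\<close>.
\<close>

unbundle no vec_syntax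
no_notation inner (infix \<open>\<bullet>\<close> 70)

section \<open>Autoregressive representation\<close>

text \<open>Scalar form of the behavior, with \<open>S u y\<close> for membership of the trajectory.
  \<open>complete\<close> is closedness in the form that gets used: trajectories agreeing with
  \<open>(u, y)\<close> on ever longer windows converge to it pointwise. \<open>not_full\<close> is
  what remains of the input cardinality being 1 and not 2.\<close>

locale siso_behavior =
  fixes S :: "(nat \<Rightarrow> real) \<Rightarrow> (nat \<Rightarrow> real) \<Rightarrow> bool"
  assumes zero: "S (\<lambda>_. 0) (\<lambda>_. 0)"
    and add: "S u y \<Longrightarrow> S u' y' \<Longrightarrow> S (\<lambda>t. u t + u' t) (\<lambda>t. y t + y' t)"
    and scale: "S u y \<Longrightarrow> S (\<lambda>t. c * u t) (\<lambda>t. c * y t)"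
    and shift_closed: "S u y \<Longrightarrow> S (\<lambda>t. u (t + 1)) (\<lambda>t. y (t + 1))"
    and complete: "(\<And>n. \<exists>u' y'. S u' y' \<and> (\<forall>s<n. u' s = u s \<and> y' s = y s)) \<Longrightarrow> S u y"
    and input_free: "S u y \<Longrightarrow>
      \<exists>u' y'. S u' y' \<and> (\<forall>s<t. u' s = u s \<and> y' s = y s) \<and> (\<forall>s\<ge>t. u' s = v s)"
    and not_full: "\<exists>u y. \<not> S u y"
begin

lemma sum_closed:
  assumes "finite I" "\<And>i. i \<in> I \<Longrightarrow> S (u i) (y i)"
  shows "S (\<lambda>t. \<Sum>i\<in>I. c i * u i t) (\<lambda>t. \<Sum>i\<in>I. c i * y i t)"
  using assms
proof (induction I rule: finite_induct)
  case (insert i I)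
  then show ?case by (simp add: add[OF scale])
qed (simp add: zero)

lemma shift_closed_iter: "S u y \<Longrightarrow> S (\<lambda>t. u (t + k)) (\<lambda>t. y (t + k))"
proof (induction k)
  case (Suc k)
  from shift_closed[OF Suc.IH[OF Suc.prems]] show ?case by (simp add: add.assoc)
qed simp

definition unconstrained :: "nat \<Rightarrow> bool"
  where "unconstrained n \<longleftrightarrow> (\<forall>u y. \<exists>u' y'. S u' y' \<and> (\<forall>s<n. u' s = u s \<and> y' s = y s))"

text \<open>Otherwise induction from the empty window would leave every finite window unconstrained,
  and completeness would then admit all pairs, against \<open>not_full\<close>.\<close>

lemma order_exists: "\<exists>d. unconstrained d \<and> \<not> unconstrained (Suc d)"
proof (rule ccontr)
  assume *: "\<not> ?thesis"
  have "unconstrained n" for n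
  proof (induction n)
    case 0
    show ?case using zero by (auto simp: unconstrained_def)
  qed (use * in blast)
  then have "S u y" for u y
    by (intro complete) (auto simp: unconstrained_def)
  with not_full show False by blast
qed

text \<open>A trajectory with zero past, zero input at \<open>d\<close> and
  \<open>y d \<noteq> 0\<close> could be scaled to correct the last output of any other one.
  Prescribing the first \<open>d\<close> samples, then the input at \<open>d\<close> by freeness,
  then the output at \<open>d\<close> by this correction would make the window of length
  \<open>d + 1\<close> unconstrained.\<close>

lemma output_determined:
  assumes d: "unconstrained d" "\<not> unconstrained (Suc d)"
    and S: "S u y" and past: "\<And>s. s < d \<Longrightarrow> u s = 0 \<and> y s = 0" and "u d = 0"
  shows "y d = 0"
proof (rule ccontr)
  assume y: "y d \<noteq> 0"
  have "\<exists>u' y'. S u' y' \<and> (\<forall>s<Suc d. u' s = u\<^sub>0 s \<and> y' s = y\<^sub>0 s)" for u\<^sub>0 y\<^sub>0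
  proof -
    from d(1) obtain u1 y1 where "S u1 y1" and 1: "\<forall>s<d. u1 s = u\<^sub>0 s \<and> y1 s = y\<^sub>0 s"
      unfolding unconstrained_def by blast
    from input_free[OF this(1), of d u\<^sub>0] obtain u2 y2 where "S u2 y2"
      and 2: "\<forall>s<d. u2 s = u1 s \<and> y2 s = y1 s" "\<forall>s\<ge>d. u2 s = u\<^sub>0 s" by blast
    define c where "c = (y\<^sub>0 d - y2 d) / y d"
    have "S (\<lambda>t. u2 t + c * u t) (\<lambda>t. y2 t + c * y t)"
      by (intro add scale S \<open>S u2 y2\<close>)
    moreover have "u2 s + c * u s = u\<^sub>0 s \<and> y2 s + c * y s = y\<^sub>0 s" if "s < Suc d" for s
      using that 1 2 past \<open>u d = 0\<close> y by (cases "s = d") (auto simp: c_def)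
    ultimately show ?thesis by blast
  qed
  with d(2) show False by (auto simp: unconstrained_def)
qed

end

text \<open>The leading output coefficient is normalized to 1, and the input sum runs one index
  further than the output sum, so that \<open>b d\<close> is the direct feedthrough.\<close>

definition arx :: "nat \<Rightarrow> (nat \<Rightarrow> real) \<Rightarrow> (nat \<Rightarrow> real) \<Rightarrow> (nat \<Rightarrow> real) \<Rightarrow> (nat \<Rightarrow> real) \<Rightarrow> bool"
  where "arx d a b u y \<longleftrightarrow>
    (\<forall>t. y (t + d) = (\<Sum>i<d. a i * y (t + i)) + (\<Sum>i\<le>d. b i * u (t + i)))"

lemma arx_unique:
  assumes "arx d a b u y" "arx d a b u y'" "\<And>s. s < d \<Longrightarrow> y s = y' s"
  shows "y t = y' t"
proof (induction t rule: less_induct)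
  case (less t)
  show ?case
  proof (cases "t < d")
    case False
    then obtain k where k: "t = k + d" by (metis le_add_diff_inverse2 not_less)
    have "(\<Sum>i<d. a i * y (k + i)) = (\<Sum>i<d. a i * y' (k + i))"
      using less by (intro sum.cong) (auto simp: k)
    then show ?thesis using assms(1,2) by (simp add: arx_def k)
  qed (use assms(3) in blast)
qed

context siso_behavior
begin

text \<open>By linearity the coefficients are the outputs at time \<open>d\<close> of basis
  trajectories that carry a single unit pulse, in one of the first \<open>d\<close> outputs or one
  of the first \<open>d + 1\<close> inputs. The second conjunct later bounds the order of every
  state space representation from below.\<close>

lemma arx_representation:
  "\<exists>d a b. (\<forall>u y. S u y \<longleftrightarrow> arx d a b u y) \<and> (\<forall>y\<^sub>0. \<exists>y. S (\<lambda>_. 0) y \<and> (\<forall>s<d. y s = y\<^sub>0 s))"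
proof -
  obtain d where d: "unconstrained d" "\<not> unconstrained (Suc d)"
    using order_exists by blast
  \<comment> \<open>The window comes from \<open>unconstrained d\<close>; freeness then fixes the
    input from \<open>d\<close> on without touching the window.\<close>
  have continue: "\<exists>u' y'. S u' y' \<and> (\<forall>s<d. u' s = u s \<and> y' s = y s) \<and> (\<forall>s\<ge>d. u' s = v s)" for u y v
  proof -
    from d(1) obtain u1 y1 where "S u1 y1" and 1: "\<forall>s<d. u1 s = u s \<and> y1 s = y s"
      unfolding unconstrained_def by blast
    with input_free[OF this(1), of d v] show ?thesis by metis
  qed
  define \<delta> :: "nat \<Rightarrow> nat \<Rightarrow> real" where "\<delta> i s = (if s = i then 1 else 0)" for i s
  have "\<exists>u' y'. S u' y' \<and> (\<forall>s<d. u' s = 0 \<and> y' s = \<delta> i s) \<and> (\<forall>s\<ge>d. u' s = 0)" for i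
    using continue[of "\<lambda>_. 0" "\<delta> i" "\<lambda>_. 0"] .
  then obtain uY yY where Y: "\<And>i. S (uY i) (yY i)"
      "\<And>i s. s < d \<Longrightarrow> yY i s = \<delta> i s" "\<And>i s. uY i s = 0"
    unfolding not_less[symmetric] by metis
  have "\<exists>u' y'. S u' y' \<and> (\<forall>s<d. u' s = \<delta> i s \<and> y' s = 0) \<and> (\<forall>s\<ge>d. u' s = \<delta> i s)" for i
    using continue[of "\<delta> i" "\<lambda>_. 0" "\<delta> i"] .
  then obtain uU yU where U: "\<And>i. S (uU i) (yU i)"
      "\<And>i s. s < d \<Longrightarrow> yU i s = 0" "\<And>i s. uU i s = \<delta> i s"
    unfolding not_less[symmetric] by metis
  define a where "a i = yY i d" for i
  define b where "b i = yU i d" for i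
  have recur0: "y d = (\<Sum>i<d. a i * y i) + (\<Sum>i\<le>d. b i * u i)" if "S u y" for u y
  proof -
    \<comment> \<open>Subtracting the matching basis trajectories leaves one that vanishes on the
      window, input at \<open>d\<close> included, so \<open>output_determined\<close> forces its
      output at \<open>d\<close> to be 0.\<close>
    let ?u = "\<lambda>t. u t + ((\<Sum>i<d. - y i * uY i t) + (\<Sum>i\<le>d. - u i * uU i t))"
    let ?y = "\<lambda>t. y t + ((\<Sum>i<d. - y i * yY i t) + (\<Sum>i\<le>d. - u i * yU i t))"
    have S: "S ?u ?y"
      by (intro add that sum_closed Y U) auto
    have u0: "?u s = 0" if "s \<le> d" for s
    proof -
      have "(\<Sum>i\<le>d. - u i * uU i s) = (\<Sum>i\<in>{..d}. if i = s then - u i else 0)"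
        by (intro sum.cong) (auto simp: U \<delta>_def)
      then show ?thesis using that by (simp add: Y)
    qed
    have y0: "?y s = 0" if "s < d" for s
    proof -
      have "(\<Sum>i<d. - y i * yY i s) = (\<Sum>i\<in>{..<d}. if i = s then - y i else 0)"
        using that by (intro sum.cong) (auto simp: Y \<delta>_def)
      then show ?thesis using that by (simp add: U)
    qed
    have "?y d = 0"
      by (rule output_determined[OF d S]) (use u0 y0 in auto)
    then show ?thesis by (simp add: a_def b_def sum_negf mult.commute)
  qed
  have recur: "arx d a b u y" if "S u y" for u y
    unfolding arx_def using recur0[OF shift_closed_iter[OF that]]
    by (simp add: add.commute)
  \<comment> \<open>Some trajectory of the behavior shares the first \<open>d\<close> outputs and
    the whole input of the given solution; it obeys the recurrence too, so the outputs agree at all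
    times.\<close>
  have "S u y" if "arx d a b u y" for u y
  proof -
    obtain u' y' where S': "S u' y'" and *: "\<forall>s<d. u' s = u s \<and> y' s = y s" "\<forall>s\<ge>d. u' s = u s"
      using continue[of u y u] by blast
    have "u' = u"
    proof
      show "u' s = u s" for s using * by (cases "s < d") auto
    qed
    with * S' have "arx d a b u y'" using recur by blast
    then have "y' = y" using arx_unique[OF _ that] * by blast
    with S' \<open>u' = u\<close> show ?thesis by simp
  qed
  moreover have "\<exists>y. S (\<lambda>_. 0) y \<and> (\<forall>s<d. y s = y\<^sub>0 s)" for y\<^sub>0
  proof -
    obtain u' y' where "S u' y'" and *: "\<forall>s<d. u' s = 0 \<and> y' s = y\<^sub>0 s" "\<forall>s\<ge>d. u' s = 0"
      using continue[of "\<lambda>_. 0" y\<^sub>0 "\<lambda>_. 0"] by blast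
    have "u' = (\<lambda>_. 0)"
    proof
      show "u' s = 0" for s using * by (cases "s < d") auto
    qed
    with \<open>S u' y'\<close> * show ?thesis by blast
  qed
  ultimately show ?thesis using recur by blast
qed

end

text \<open>
  The state of the observer canonical form is \<open>(z t 1, \<dots>, z t d)\<close>; the padding \<open>z t 0 = 0\<close>
  avoids a special case for \<open>d = 0\<close>.
\<close>

lemma arx_iff_observer_form:
  "arx d a b u y \<longleftrightarrow>
    (\<exists>z. (\<forall>t. z t 0 = 0) \<and> (\<forall>t. \<forall>k<d. z (t + 1) (Suc k) = z t k + a k * y t + b k * u t)
       \<and> (\<forall>t. y t = z t d + b d * u t))" (is "_ \<longleftrightarrow> ?R")
proof
  assume arx: "arx d a b u y"
  \<comment> \<open>The recurrence started at \<open>t - k\<close> splits into terms before time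
    \<open>t\<close> (indices below \<open>k\<close>) and the rest; the state is the part before
    \<open>t\<close>. Writing it as the output minus the rest keeps it defined for
    \<open>t < k\<close>.\<close>
  define z where "z t k = (if k = 0 then 0 else
     y (t + (d - k)) - (\<Sum>i\<in>{k..<d}. a i * y (t + (i - k))) - (\<Sum>i\<in>{k..d}. b i * u (t + (i - k))))"
    for t k
  have step: "z (t + 1) (Suc k) = z t k + a k * y t + b k * u t" if "k < d" for t k
  proof -
    let ?Y = "\<Sum>i\<in>{Suc k..<d}. a i * y (t + (i - k))"
    let ?U = "\<Sum>i\<in>{Suc k..d}. b i * u (t + (i - k))"
    have "(\<Sum>i\<in>{Suc k..<d}. a i * y (t + 1 + (i - Suc k))) = ?Y"
      "(\<Sum>i\<in>{Suc k..d}. b i * u (t + 1 + (i - Suc k))) = ?U"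
      by (intro sum.cong; simp add: Suc_diff_Suc)+
    then have z1: "z (t + 1) (Suc k) = y (t + (d - k)) - ?Y - ?U"
      using that by (simp add: z_def Suc_diff_Suc)
    have s: "(\<Sum>i\<in>{k..<d}. a i * y (t + (i - k))) = a k * y t + ?Y"
      "(\<Sum>i\<in>{k..d}. b i * u (t + (i - k))) = b k * u t + ?U"
      using that by (simp_all add: sum.atLeast_Suc_lessThan sum.atLeast_Suc_atMost)
    show ?thesis
    proof (cases "k = 0")
      case True
      \<comment> \<open>At \<open>k = 0\<close> the state is 0 by the padding; the recurrence at
        \<open>t\<close> says that the general formula would give 0 as well.\<close>
      from arx have "y (t + d) = (\<Sum>i<d. a i * y (t + i)) + (\<Sum>i\<le>d. b i * u (t + i))"
        by (simp add: arx_def)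
      with True s z1 show ?thesis by (simp add: z_def atLeast0LessThan atLeast0AtMost)
    next
      case False
      with s z1 show ?thesis by (simp add: z_def)
    qed
  qed
  have out: "y t = z t d + b d * u t" for t
    using arx by (cases "d = 0") (auto simp: z_def arx_def)
  have "z t 0 = 0" for t by (simp add: z_def)
  with step out show ?R by (intro exI[of _ z] conjI allI impI) assumption+
next
  assume ?R
  then obtain z where z: "\<forall>t. z t 0 = 0"
      "\<forall>t. \<forall>k<d. z (t + 1) (Suc k) = z t k + a k * y t + b k * u t"
      "\<forall>t. y t = z t d + b d * u t"
    by (elim exE conjE)
  have z0: "z t 0 = 0" and out: "y t = z t d + b d * u t" for t
    using z by auto
  have step: "z (t + 1) (Suc k) = z t k + a k * y t + b k * u t" if "k < d" for t k
    using z(2) that by blast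
  \<comment> \<open>Starting from the zero padding, \<open>k\<close> steps along the chain
    accumulate the terms of the recurrence with index below \<open>k\<close>; at
    \<open>k = d\<close> the output equation adds the missing term \<open>b d\<close>.\<close>
  have state: "z (t + k) k = (\<Sum>i<k. a i * y (t + i)) + (\<Sum>i<k. b i * u (t + i))" if "k \<le> d" for t k
    using that
  proof (induction k)
    case (Suc k)
    then have "k < d" by simp
    from step[OF this, of "t + k"] show ?case
      using Suc.IH \<open>k < d\<close> by simp
  qed (simp add: z0)
  show "arx d a b u y"
    unfolding arx_def
  proof
    fix t
    show "y (t + d) = (\<Sum>i<d. a i * y (t + i)) + (\<Sum>i\<le>d. b i * u (t + i))"
      using out[of "t + d"] state[of d t] by (simp add: lessThan_Suc_atMost[symmetric])
  qed
qed

text \<open>\<open>h k\<close> is the response \<open>k\<close> steps after the pulse, and there the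
  pulse meets the coefficient \<open>b (d - k)\<close>. While all earlier responses vanish, the
  output sum contributes nothing, so \<open>h k = b (d - k)\<close>; increasing \<open>k\<close>
  scans \<open>b\<close> downwards from \<open>d\<close> and stops at \<delta>.\<close>

lemma arx_impulse:
  assumes arx: "arx d a b (\<lambda>t. if t = d then 1 else 0) (\<lambda>t. if t < d then 0 else h (t - d))"
    and \<delta>: "\<delta> \<le> d" "b \<delta> \<noteq> 0" "\<And>i. \<delta> < i \<Longrightarrow> i \<le> d \<Longrightarrow> b i = 0"
  shows "h (d - \<delta>) \<noteq> 0" and "\<And>k. k < d - \<delta> \<Longrightarrow> h k = 0"
proof -
  let ?y = "\<lambda>t. if t < d then 0 else h (t - d)"
  have h: "h k = (\<Sum>i<d. a i * ?y (k + i)) + (if k \<le> d then b (d - k) else 0)" for k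
  proof -
    have "(\<Sum>i\<le>d. b i * (if k + i = d then 1 else 0)) = (\<Sum>i\<in>{..d}. if i = d - k \<and> k \<le> d then b i else 0)"
      by (intro sum.cong) auto
    also have "\<dots> = (if k \<le> d then b (d - k) else 0)" by (cases "k \<le> d") (auto)
    finally have inp: "(\<Sum>i\<le>d. b i * (if k + i = d then 1 else 0)) = \<dots>" .
    have "?y (k + d) = (\<Sum>i<d. a i * ?y (k + i)) + (\<Sum>i\<le>d. b i * (if k + i = d then 1 else 0))"
      using arx unfolding arx_def by blast
    then have "?y (k + d) = (\<Sum>i<d. a i * ?y (k + i)) + (if k \<le> d then b (d - k) else 0)"
      unfolding inp .
    moreover have "?y (k + d) = h k" by simp
    ultimately show ?thesis by (rule trans[OF sym, rotated])
  qed
  have hb: "h k = b (d - k)" if "k \<le> d" "\<And>j. j < k \<Longrightarrow> h j = 0" for k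
  proof -
    have "(\<Sum>i<d. a i * ?y (k + i)) = 0"
      using that by (intro sum.neutral) auto
    with h[of k] that show ?thesis by simp
  qed
  show 0: "h k = 0" if "k < d - \<delta>" for k
    using that
  proof (induction k rule: less_induct)
    case (less k)
    then have "h k = b (d - k)" by (intro hb) auto
    with less.prems \<delta>(3)[of "d - k"] show ?case by simp
  qed
  show "h (d - \<delta>) \<noteq> 0" using hb[of "d - \<delta>"] 0 \<delta> by simp
qed


section \<open>Matrices\<close>

text \<open>The number of columns bounds the rank. Finiteness is what lets a free signal bound the
  \<open>Max\<close> in \<open>input_card\<close> from below.\<close>

lemma finite_rank_bounded: "finite {k. \<exists>P \<in> carrier_mat k w. vec_space.rank k P = k \<and> Q k (P :: real mat)}"
proof (rule finite_subset)
  show "{k. \<exists>P \<in> carrier_mat k w. vec_space.rank k P = k \<and> Q k P} \<subseteq> {..w}"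
  proof
    fix k assume "k \<in> {k. \<exists>P \<in> carrier_mat k w. vec_space.rank k P = k \<and> Q k P}"
    then obtain P :: "real mat" where "P \<in> carrier_mat k w" "vec_space.rank k P = k" by blast
    then show "k \<in> {..w}" using vec_space.rank_le_nc[of P k w] by simp
  qed
qed simp

text \<open>The rank counts a maximal independent set of columns, and these lie in a space of
  dimension \<open>nr\<close>. This serves the lower bound on the lag.\<close>

lemma rank_le_nr:
  fixes A :: "'a :: field mat"
  assumes "A \<in> carrier_mat nr nc"
  shows "vec_space.rank nr A \<le> nr"
proof -
  interpret vec_space "TYPE('a)" nr .
  let ?P = "\<lambda>U. U \<subseteq> set (cols A) \<and> lin_indpt U"
  have sub: "set (cols A) \<subseteq> carrier_vec nr" using assms cols_dim by blast
  obtain U where U: "maximal U ?P"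
    using maximal_exists_superset[of "set (cols A)" ?P "{}"] by (auto simp: finite_lin_indpt2)
  then have *: "U \<subseteq> carrier_vec nr" "lin_indpt U"
    using sub by (auto simp: maximal_def)
  have "card U \<le> dim" using li_le_dim(2)[OF fin_dim *] .
  then show ?thesis using rank_card_indpt[OF assms U] by (simp add: dim_is_n)
qed

text \<open>If \<open>n < d\<close>, padding both factors with zeros to square matrices gives a
  one-sided inverse, hence a two-sided one; but row \<open>n\<close> of the padded \<open>Q\<close>
  is zero, so the reversed product has a 0 on its diagonal.\<close>

lemma factor_through_dim_le:
  fixes p q :: "nat \<Rightarrow> nat \<Rightarrow> real"
  assumes pq: "\<And>k i. k < d \<Longrightarrow> i < d \<Longrightarrow> (\<Sum>j<n. p k j * q j i) = (if k = i then 1 else 0)"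
  shows "d \<le> n"
proof (rule ccontr)
  assume "\<not> d \<le> n"
  then have n: "n < d" by simp
  define P where "P = mat d d (\<lambda>(k, j). if j < n then p k j else 0)"
  define Q where "Q = mat d d (\<lambda>(j, i). if j < n then q j i else 0)"
  have "P * Q = 1\<^sub>m d"
  proof (rule eq_matI)
    fix k i assume "k < dim_row (1\<^sub>m d :: real mat)" "i < dim_col (1\<^sub>m d :: real mat)"
    then have ki: "k < d" "i < d" by auto
    then have "(P * Q) $$ (k, i)
        = (\<Sum>j\<in>{0..<d}. (if j < n then p k j else 0) * (if j < n then q j i else 0))"
      by (simp add: P_def Q_def scalar_prod_def)
    also have "\<dots> = (\<Sum>j<n. p k j * q j i)"
      using n by (intro sum.mono_neutral_cong_right) auto
    finally show "(P * Q) $$ (k, i) = 1\<^sub>m d $$ (k, i)" using ki by (simp add: pq)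
  qed (auto simp: P_def Q_def)
  then have "Q * P = 1\<^sub>m d"
    by (rule mat_mult_left_right_inverse[rotated -1]) (auto simp: P_def Q_def)
  then have "(Q * P) $$ (n, n) = 1" using n by simp
  moreover have "(Q * P) $$ (n, n) = 0"
    using n by (simp add: P_def Q_def scalar_prod_def)
  ultimately show False by simp
qed

lemma pow_mat_Suc_left:
  fixes A :: "'a :: semiring_1 mat"
  assumes "A \<in> carrier_mat n n"
  shows "A ^\<^sub>m Suc k = A * A ^\<^sub>m k"
proof (induction k)
  case (Suc k)
  have "A ^\<^sub>m Suc (Suc k) = A * A ^\<^sub>m k * A" using Suc by simp
  also have "\<dots> = A * A ^\<^sub>m Suc k"
    using assms by (simp add: assoc_mult_mat[of _ n n _ n _ n])
  finally show ?case .
qed (use assms in simp)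

lemma pow_mat_mult_vec_Suc:
  fixes A :: "'a :: semiring_1 mat"
  assumes "A \<in> carrier_mat n n" "v \<in> carrier_vec n"
  shows "A ^\<^sub>m Suc k *\<^sub>v v = A *\<^sub>v (A ^\<^sub>m k *\<^sub>v v)"
  unfolding pow_mat_Suc_left[OF assms(1)]
  by (rule assoc_mult_mat_vec) (use assms in auto)

lemma obs_mat_carrier:
  assumes "A \<in> carrier_mat n n" "C \<in> carrier_mat 1 n"
  shows "obs_mat L A C \<in> carrier_mat L n"
proof (induction L)
  case (Suc L)
  have "C * A ^\<^sub>m L \<in> carrier_mat 1 n" using assms by (intro mult_carrier_mat) auto
  from carrier_append_rows[OF Suc this] show ?case by simp
qed (use assms in simp)

lemma obs_mat_mult_vec:
  assumes A: "A \<in> carrier_mat n n" and C: "C \<in> carrier_mat 1 n" and v: "v \<in> carrier_vec n" and "k < L"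
  shows "(obs_mat L A C *\<^sub>v v) $ k = row C 0 \<bullet> (A ^\<^sub>m k *\<^sub>v v)"
  using \<open>k < L\<close>
proof (induction L)
  case (Suc L)
  have CA: "C * A ^\<^sub>m L \<in> carrier_mat 1 n" using A C by (intro mult_carrier_mat) auto
  note O = obs_mat_carrier[OF A C, of L]
  have "(C * A ^\<^sub>m L) *\<^sub>v v = C *\<^sub>v (A ^\<^sub>m L *\<^sub>v v)"
    using A C v by (intro assoc_mult_mat_vec) auto
  then have "obs_mat (Suc L) A C *\<^sub>v v = (obs_mat L A C *\<^sub>v v) @\<^sub>v (C *\<^sub>v (A ^\<^sub>m L *\<^sub>v v))"
    using mat_mult_append[OF O CA v] by simp
  with Suc O C show ?case by (cases "k = L") auto
qed simp

lemma row_mult_mult_col: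
  fixes A B C :: "real mat"
  assumes A: "A \<in> carrier_mat n n" and B: "B \<in> carrier_mat n 1" and C: "C \<in> carrier_mat 1 n"
  shows "row C 0 \<bullet> (A ^\<^sub>m k *\<^sub>v col B 0) = (C * A ^\<^sub>m k * B) $$ (0, 0)"
proof -
  have CA: "C * A ^\<^sub>m k \<in> carrier_mat 1 n" using A C by (intro mult_carrier_mat) auto
  have c: "col B 0 \<in> carrier_vec n" using B by auto
  have "(C * A ^\<^sub>m k) *\<^sub>v col B 0 = C *\<^sub>v (A ^\<^sub>m k *\<^sub>v col B 0)"
    using A C c by (intro assoc_mult_mat_vec) auto
  then have "((C * A ^\<^sub>m k) *\<^sub>v col B 0) $ 0 = row C 0 \<bullet> (A ^\<^sub>m k *\<^sub>v col B 0)"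
    using C by simp
  with CA B C A show ?thesis by simp
qed

section \<open>State space representations\<close>

definition pair_vec :: "real \<Rightarrow> real \<Rightarrow> real vec"
  where "pair_vec c d = vec 2 (\<lambda>i. if i = 0 then c else d)"

lemma pair_vec_simps [simp]:
  "pair_vec c d $ 0 = c" "pair_vec c d $ Suc 0 = d" "pair_vec c d \<in> carrier_vec 2"
  "dim_vec (pair_vec c d) = 2"
  by (simp_all add: pair_vec_def)

lemma pair_vec_eq: "v \<in> carrier_vec 2 \<Longrightarrow> pair_vec (v $ 0) (v $ 1) = v"
  by (intro eq_vecI) (auto simp: pair_vec_def less_2_cases_iff)

definition signals :: "behavior \<Rightarrow> (nat \<Rightarrow> real) \<Rightarrow> (nat \<Rightarrow> real) \<Rightarrow> bool"
  where "signals \<B> u y \<longleftrightarrow> (\<lambda>t. pair_vec (u t) (y t)) \<in> \<B>"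

lemma siso_behavior_signals:
  assumes B: "\<B> \<in> \<L> 2" and m: "input_card 2 \<B> = 1" and io: "io_partitioned 2 \<B>"
  shows "siso_behavior (signals \<B>)"
proof
  let ?P = "mat 1 2 (\<lambda>(i, j). if i = j then 1 else 0) :: real mat"
  from B have sub: "\<And>f t. f \<in> \<B> \<Longrightarrow> f t \<in> carrier_vec 2"
    and zero: "(\<lambda>_. 0\<^sub>v 2) \<in> \<B>"
    and add: "\<And>f g. f \<in> \<B> \<Longrightarrow> g \<in> \<B> \<Longrightarrow> (\<lambda>t. f t + g t) \<in> \<B>"
    and scale: "\<And>c f. f \<in> \<B> \<Longrightarrow> (\<lambda>t. c \<cdot>\<^sub>v f t) \<in> \<B>"
    and shift: "\<And>f. f \<in> \<B> \<Longrightarrow> \<sigma> f \<in> \<B>"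
    and lim: "\<And>F f. (\<And>k. F k \<in> \<B>) \<Longrightarrow> (\<And>t. f t \<in> carrier_vec 2) \<Longrightarrow> pointwise_limit 2 F f \<Longrightarrow> f \<in> \<B>"
    unfolding LTI_def by blast+
  have pair: "signals \<B> (\<lambda>t. f t $ 0) (\<lambda>t. f t $ 1)" if "f \<in> \<B>" for f
  proof -
    have "(\<lambda>t. pair_vec (f t $ 0) (f t $ 1)) = f"
      using sub[OF that] by (intro ext pair_vec_eq)
    with that show ?thesis by (simp add: signals_def)
  qed
  show "signals \<B> (\<lambda>_. 0) (\<lambda>_. 0)"
    using pair[OF zero] by simp
  show "signals \<B> (\<lambda>t. u t + u' t) (\<lambda>t. y t + y' t)" if "signals \<B> u y" "signals \<B> u' y'" for u y u' y'
    using pair[OF add[OF that[unfolded signals_def]]] by simp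
  show "signals \<B> (\<lambda>t. c * u t) (\<lambda>t. c * y t)" if "signals \<B> u y" for u y c
    using pair[OF scale[OF that[unfolded signals_def], of c]] by simp
  show "signals \<B> (\<lambda>t. u (t + 1)) (\<lambda>t. y (t + 1))" if "signals \<B> u y" for u y
    using shift[OF that[unfolded signals_def]] by (simp add: shift_def signals_def)
  show complete: "signals \<B> u y"
    if "\<And>n. \<exists>u' y'. signals \<B> u' y' \<and> (\<forall>s<n. u' s = u s \<and> y' s = y s)" for u y
  proof -
    from that obtain U Y where UY: "\<And>n. signals \<B> (U n) (Y n)"
      "\<And>n s. s < n \<Longrightarrow> U n s = u s \<and> Y n s = y s" by metis
    show ?thesis
      unfolding signals_def
    proof (rule lim)
      show "(\<lambda>t. pair_vec (U k t) (Y k t)) \<in> \<B>" for k by (rule UY[unfolded signals_def])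
      \<comment> \<open>At each fixed time the approximating sequence is eventually constant, so it
        converges.\<close>
      have "\<forall>\<^sub>F k in sequentially. pair_vec (U k t) (Y k t) $ i = pair_vec (u t) (y t) $ i" for t i
        using eventually_gt_at_top[of t] by eventually_elim (simp add: UY)
      then show "pointwise_limit 2 (\<lambda>k t. pair_vec (U k t) (Y k t)) (\<lambda>t. pair_vec (u t) (y t))"
        unfolding pointwise_limit_def by (intro allI impI tendsto_eventually)
    qed simp
  qed
  show "\<exists>u' y'. signals \<B> u' y' \<and> (\<forall>s<t. u' s = u s \<and> y' s = y s) \<and> (\<forall>s\<ge>t. u' s = v s)"
    if "signals \<B> u y" for u y t v
  proof -
    have "free_signal \<B> 1 ?P" using io by (simp add: io_partitioned_def m)
    then have "\<exists>g\<in>\<B>. (\<forall>s<t. g s = pair_vec (u s) (y s)) \<and> (\<forall>s\<ge>t. ?P *\<^sub>v g s = vec 1 (\<lambda>_. v s))"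
      using that unfolding free_signal_def signals_def by (elim ballE[of _ _ "\<lambda>t. pair_vec (u t) (y t)"]) auto
    then obtain g where g: "g \<in> \<B>" "\<And>s. s < t \<Longrightarrow> g s = pair_vec (u s) (y s)"
      "\<And>s. t \<le> s \<Longrightarrow> ?P *\<^sub>v g s = vec 1 (\<lambda>_. v s)" by blast
    have "g s $ 0 = v s" if "t \<le> s" for s
    proof -
      have "(?P *\<^sub>v g s) $ 0 = g s $ 0"
        using sub[OF g(1), of s] by (simp add: scalar_prod_def numeral_2_eq_2)
      with g(3)[OF that] show ?thesis by simp
    qed
    with pair[OF g(1)] g(2) show ?thesis
      by (intro exI[of _ "\<lambda>t. g t $ 0"] exI[of _ "\<lambda>t. g t $ 1"]) auto
  qed
  show "\<exists>u y. \<not> signals \<B> u y"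
  proof (rule ccontr)
    \<comment> \<open>If every pair were a trajectory, both components together would be free, and
      the identity of rank 2 would push the input cardinality to 2.\<close>
    assume full: "\<not> ?thesis"
    have all: "f \<in> \<B>" if "\<And>t. f t \<in> carrier_vec 2" for f
    proof -
      have "(\<lambda>t. pair_vec (f t $ 0) (f t $ 1)) = f"
        using that by (intro ext pair_vec_eq)
      then show ?thesis using full unfolding signals_def by metis
    qed
    have "free_signal \<B> 2 (1\<^sub>m 2)"
      unfolding free_signal_def
    proof (intro ballI allI impI)
      fix f t and v :: traj assume f: "f \<in> \<B>" and v: "\<forall>s. v s \<in> carrier_vec 2"
      show "\<exists>g\<in>\<B>. (\<forall>s<t. g s = f s) \<and> (\<forall>s\<ge>t. 1\<^sub>m 2 *\<^sub>v g s = v s)"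
        using v by (intro bexI[of _ "\<lambda>s. if s < t then f s else v s"] all) (auto intro: sub[OF f])
    qed
    moreover have "vec_space.rank 2 (1\<^sub>m 2 :: real mat) = 2"
      using vec_space.det_rank_iff[of "1\<^sub>m 2 :: real mat" 2] by simp
    ultimately have "2 \<le> input_card 2 \<B>"
      unfolding input_card_def
      by (intro Max_ge finite_rank_bounded) (auto intro: bexI[of _ "1\<^sub>m 2"])
    with m show False by simp
  qed
qed

text \<open>Inputs and outputs in dimension 1 become scalars and only the state stays a vector. Both
  the behavior and the set of system trajectories consist of sequences in the plane, so comparing
  them on pairs of scalar signals decides their equality.\<close>

lemma ss_rep_siso_iff:
  assumes B: "\<B> \<in> \<L> 2" and m: "input_card 2 \<B> = 1" and p: "output_card 2 \<B> = 1"
  shows "ss_rep 2 \<B> n A B C D \<longleftrightarrow>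
    A \<in> carrier_mat n n \<and> B \<in> carrier_mat n 1 \<and> C \<in> carrier_mat 1 n \<and> D \<in> carrier_mat 1 1 \<and>
    (\<forall>u y. signals \<B> u y \<longleftrightarrow>
      (\<exists>x. (\<forall>t. x t \<in> carrier_vec n) \<and> (\<forall>t. x (t + 1) = A *\<^sub>v x t + u t \<cdot>\<^sub>v col B 0)
         \<and> (\<forall>t. y t = row C 0 \<bullet> x t + D $$ (0, 0) * u t)))"
    (is "_ \<longleftrightarrow> ?A \<and> ?B \<and> ?C \<and> ?D \<and> (\<forall>u y. _ \<longleftrightarrow> ?sys u y)")
proof -
  have sub: "f t \<in> carrier_vec 2" if "f \<in> \<B>" for f t
    using B that by (auto simp: LTI_def)
  define v1 :: "real \<Rightarrow> real vec" where "v1 c = vec 1 (\<lambda>_. c)" for c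
  have v1: "v1 c \<in> carrier_vec 1" "v1 c $ 0 = c" "v1 c @\<^sub>v v1 e = pair_vec c e" for c e
    by (auto simp: v1_def pair_vec_def append_vec_def numeral_2_eq_2 intro!: eq_vecI)
  have v1_eq: "v1 (v $ 0) = v" if "v \<in> carrier_vec 1" for v
    using that by (auto simp: v1_def)
  have v1_inj: "v1 c = v1 e \<longleftrightarrow> c = e" for c e using v1(2) by metis
  define R :: behavior where "R = {f. \<exists>u y x. (\<forall>t. u t \<in> carrier_vec 1) \<and> (\<forall>t. y t \<in> carrier_vec 1) \<and>
                (\<forall>t. x t \<in> carrier_vec n) \<and> (\<forall>t. f t = u t @\<^sub>v y t) \<and>
                (\<forall>t. x (t + 1) = A *\<^sub>v x t + B *\<^sub>v u t) \<and>
                (\<forall>t. y t = C *\<^sub>v x t + D *\<^sub>v u t)}"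
  have rep: "ss_rep 2 \<B> n A B C D \<longleftrightarrow> ?A \<and> ?B \<and> ?C \<and> ?D \<and> \<B> = R"
    by (simp add: ss_rep_def m p R_def Let_def)
  have "\<B> = R \<longleftrightarrow> (\<forall>u y. signals \<B> u y \<longleftrightarrow> ?sys u y)" if c: ?A ?B ?C ?D
  proof -
    have Bv: "B *\<^sub>v v1 e = e \<cdot>\<^sub>v col B 0" for e
      using c(2) by (intro eq_vecI) (auto simp: v1_def scalar_prod_def)
    have CD: "C *\<^sub>v x + D *\<^sub>v v1 e = v1 (row C 0 \<bullet> x + D $$ (0, 0) * e)" for x e
      using c(3,4) by (intro eq_vecI) (auto simp: v1_def scalar_prod_def)
    have R_iff: "(\<lambda>t. pair_vec (u t) (y t)) \<in> R \<longleftrightarrow> ?sys u y" for u y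
    proof
      assume "(\<lambda>t. pair_vec (u t) (y t)) \<in> R"
      then obtain u' y' x where *: "\<forall>t. u' t \<in> carrier_vec 1" "\<forall>t. y' t \<in> carrier_vec 1"
        "\<forall>t. x t \<in> carrier_vec n" "\<forall>t. pair_vec (u t) (y t) = u' t @\<^sub>v y' t"
        "\<forall>t. x (t + 1) = A *\<^sub>v x t + B *\<^sub>v u' t" "\<forall>t. y' t = C *\<^sub>v x t + D *\<^sub>v u' t"
        unfolding R_def mem_Collect_eq by (elim exE conjE)
      have eq: "u' t = v1 (u t)" "y' t = v1 (y t)" for t
      proof -
        have "v1 (u t) @\<^sub>v v1 (y t) = u' t @\<^sub>v y' t" using *(4) by (simp only: v1(3))
        then show "u' t = v1 (u t)" "y' t = v1 (y t)"
          by (simp_all only: append_vec_eq[OF v1(1) *(1)[rule_format]])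
      qed
      have "y t = row C 0 \<bullet> x t + D $$ (0, 0) * u t" for t
        using *(6)[rule_format, of t] eq[of t] by (simp only: CD v1_inj)
      moreover have "x (t + 1) = A *\<^sub>v x t + u t \<cdot>\<^sub>v col B 0" for t
        using *(5)[rule_format, of t] eq[of t] by (simp only: Bv)
      ultimately show "?sys u y" using *(3) by (intro exI[of _ x] conjI allI) auto
    next
      assume "?sys u y"
      then obtain x where x: "\<forall>t. x t \<in> carrier_vec n" "\<forall>t. x (t + 1) = A *\<^sub>v x t + u t \<cdot>\<^sub>v col B 0"
        "\<forall>t. y t = row C 0 \<bullet> x t + D $$ (0, 0) * u t" by (elim exE conjE)
      then show "(\<lambda>t. pair_vec (u t) (y t)) \<in> R"
        unfolding R_def mem_Collect_eq
        by (intro exI[of _ "\<lambda>t. v1 (u t)"] exI[of _ "\<lambda>t. v1 (y t)"] exI[of _ x])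
          (simp only: v1 Bv CD, simp)
    qed
    show ?thesis
    proof
      assume eq: "\<B> = R"
      show "\<forall>u y. signals \<B> u y \<longleftrightarrow> ?sys u y"
        by (intro allI) (simp only: signals_def eq R_iff)
    next
      assume *: "\<forall>u y. signals \<B> u y \<longleftrightarrow> ?sys u y"
      have R2: "f t \<in> carrier_vec 2" if "f \<in> R" for f t
      proof -
        from that obtain u y x where "\<forall>t. u t \<in> carrier_vec 1" "\<forall>t. y t \<in> carrier_vec 1"
          "\<forall>t. x t \<in> carrier_vec n" "\<forall>t. f t = u t @\<^sub>v y t"
          "\<forall>t. x (t + 1) = A *\<^sub>v x t + B *\<^sub>v u t" "\<forall>t. y t = C *\<^sub>v x t + D *\<^sub>v u t"
          unfolding R_def mem_Collect_eq by (elim exE conjE)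
        then show ?thesis
          using append_carrier_vec[of "u t" 1 "y t" 1] by (simp only: one_add_one simp_thms)
      qed
      have "f \<in> \<B> \<longleftrightarrow> f \<in> R" if "\<And>t. f t \<in> carrier_vec 2" for f
      proof -
        have f: "(\<lambda>t. pair_vec (f t $ 0) (f t $ 1)) = f"
          using that by (intro ext pair_vec_eq)
        show ?thesis
          using *[rule_format, of "\<lambda>t. f t $ 0" "\<lambda>t. f t $ 1", folded R_iff]
          unfolding signals_def f .
      qed
      then show "\<B> = R" using sub R2 by blast
    qed
  qed
  then show ?thesis using rep by blast
qed

text \<open>The last assumption forces every state space representation to have order at least \<open>d\<close>.\<close>

locale siso_arx =
  fixes \<B> :: behavior and d :: nat and a b :: "nat \<Rightarrow> real"
  assumes LTI: "\<B> \<in> \<L> 2" and input_card: "input_card 2 \<B> = 1" and output_card: "output_card 2 \<B> = 1"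
    and signals_iff_arx: "signals \<B> u y \<longleftrightarrow> arx d a b u y"
    and zero_input_response: "\<exists>y. signals \<B> (\<lambda>_. 0) y \<and> (\<forall>s<d. y s = y\<^sub>0 s)"
begin

section \<open>Lower bound on the order of a representation\<close>

lemmas rep_iff = ss_rep_siso_iff[OF LTI input_card output_card]

lemma rep_zero_input:
  assumes rep: "ss_rep 2 \<B> n A B C D" and v: "v \<in> carrier_vec n"
  shows "signals \<B> (\<lambda>_. 0) (\<lambda>t. row C 0 \<bullet> (A ^\<^sub>m t *\<^sub>v v))"
proof -
  have c: "A \<in> carrier_mat n n" "B \<in> carrier_mat n 1" "C \<in> carrier_mat 1 n"
    using rep unfolding rep_iff by blast+
  have "A ^\<^sub>m (t + 1) *\<^sub>v v = A *\<^sub>v (A ^\<^sub>m t *\<^sub>v v) + 0 \<cdot>\<^sub>v col B 0" for t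
    using pow_mat_mult_vec_Suc[OF c(1) v, of t] c v
    by (intro eq_vecI) (simp_all del: pow_mat.simps)
  moreover have "A ^\<^sub>m t *\<^sub>v v \<in> carrier_vec n" for t
    using c v by (intro mult_mat_vec_carrier[of _ n n]) auto
  ultimately have "\<exists>x. (\<forall>t. x t \<in> carrier_vec n) \<and> (\<forall>t. x (t + 1) = A *\<^sub>v x t + 0 \<cdot>\<^sub>v col B 0)
         \<and> (\<forall>t. row C 0 \<bullet> (A ^\<^sub>m t *\<^sub>v v) = row C 0 \<bullet> x t + D $$ (0, 0) * 0)"
    by (intro exI[of _ "\<lambda>t. A ^\<^sub>m t *\<^sub>v v"]) simp
  with rep show ?thesis unfolding rep_iff by blast
qed

lemma zero_input_state:
  assumes rep: "ss_rep 2 \<B> n A B C D" and y: "signals \<B> (\<lambda>_. 0) y"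
  shows "\<exists>v\<in>carrier_vec n. \<forall>t. y t = row C 0 \<bullet> (A ^\<^sub>m t *\<^sub>v v)"
proof -
  have c: "A \<in> carrier_mat n n" "B \<in> carrier_mat n 1" "C \<in> carrier_mat 1 n"
    using rep unfolding rep_iff by blast+
  obtain x where x: "\<And>t. x t \<in> carrier_vec n" "\<And>t. x (t + 1) = A *\<^sub>v x t + 0 \<cdot>\<^sub>v col B 0"
      "\<And>t. y t = row C 0 \<bullet> x t + D $$ (0, 0) * 0"
    using rep[unfolded rep_iff, THEN conjunct2, THEN conjunct2, THEN conjunct2, THEN conjunct2,
        rule_format, THEN iffD1, OF y] by (elim exE conjE) blast
  have sol: "x t = A ^\<^sub>m t *\<^sub>v x 0" for t
  proof (induction t)
    case (Suc t)
    have "A *\<^sub>v x t + 0 \<cdot>\<^sub>v col B 0 = A *\<^sub>v x t"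
      using c by (intro eq_vecI) auto
    then show ?case
      using x(2)[of t] Suc pow_mat_mult_vec_Suc[OF c(1) x(1), of t 0] by simp
  qed (use c x(1)[of 0] in simp)
  show ?thesis by (intro bexI[of _ "x 0"] x(1)) (simp add: x(3) sol[symmetric])
qed

text \<open>Under zero input the first \<open>d\<close> outputs can be prescribed as each unit
  vector, and each such response comes from an initial state \<open>v i\<close>. The rows
  \<open>C * A ^\<^sub>m k\<close> applied to these states give the identity of size
  \<open>d\<close>, which thus factors through dimension \<open>n\<close>.\<close>

lemma order_le: "ss_rep 2 \<B> n A B C D \<Longrightarrow> d \<le> n"
proof -
  assume rep: "ss_rep 2 \<B> n A B C D"
  have "\<exists>v\<in>carrier_vec n. \<forall>t<d. row C 0 \<bullet> (A ^\<^sub>m t *\<^sub>v v) = (if t = i then 1 else 0)" for i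
    using zero_input_response[of "\<lambda>t. if t = i then 1 else 0"] zero_input_state[OF rep] by metis
  then obtain v where v: "\<And>i. v i \<in> carrier_vec n"
      "\<And>i t. t < d \<Longrightarrow> row C 0 \<bullet> (A ^\<^sub>m t *\<^sub>v v i) = (if t = i then 1 else 0)" by metis
  have c: "A \<in> carrier_mat n n" "C \<in> carrier_mat 1 n"
    using rep unfolding rep_iff by blast+
  show ?thesis
  proof (rule factor_through_dim_le[where p = "\<lambda>k j. (C * A ^\<^sub>m k) $$ (0, j)" and q = "\<lambda>j i. v i $ j"])
    fix k i assume "k < d" "i < d"
    have CA: "C * A ^\<^sub>m k \<in> carrier_mat 1 n" using c by (intro mult_carrier_mat) auto
    have "row C 0 \<bullet> (A ^\<^sub>m k *\<^sub>v v i) = (C *\<^sub>v (A ^\<^sub>m k *\<^sub>v v i)) $ 0" using c by simp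
    also have "C *\<^sub>v (A ^\<^sub>m k *\<^sub>v v i) = (C * A ^\<^sub>m k) *\<^sub>v v i"
      using c v by (intro assoc_mult_mat_vec[symmetric]) auto
    also have "\<dots> $ 0 = (\<Sum>j<n. (C * A ^\<^sub>m k) $$ (0, j) * v i $ j)"
    proof -
      have "(M *\<^sub>v w) $ 0 = (\<Sum>j<n. M $$ (0, j) * w $ j)"
        if "M \<in> carrier_mat 1 n" "w \<in> carrier_vec n" for M :: "real mat" and w
        using that by (auto simp: scalar_prod_def atLeast0LessThan)
      with CA v(1) show ?thesis by blast
    qed
    finally show "(\<Sum>j<n. (C * A ^\<^sub>m k) $$ (0, j) * v i $ j) = (if k = i then 1 else 0)"
      using v(2)[OF \<open>k < d\<close>] by simp
  qed
qed

section \<open>Observer canonical form\<close>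

definition observer_A :: "real mat"
  where "observer_A = mat d d (\<lambda>(i, j). (if i = Suc j then 1 else 0) + (if Suc j = d then a i else 0))"

text \<open>The recursion feeds back \<open>y t\<close>, which itself contains
  \<open>b d * u t\<close>; this is the source of \<open>a i * b d\<close>.\<close>

definition observer_B :: "real mat"
  where "observer_B = mat d 1 (\<lambda>(i, _). b i + a i * b d)"

definition observer_C :: "real mat"
  where "observer_C = mat 1 d (\<lambda>(_, j). if Suc j = d then 1 else 0)"

definition observer_D :: "real mat"
  where "observer_D = mat 1 1 (\<lambda>_. b d)"

text \<open>Reads a state vector with the numbering \<open>z t 0, ..., z t d\<close>, padding
  included, so that \<open>entry x d\<close> is the output part even when
  \<open>d = 0\<close>.\<close>

definition entry :: "real vec \<Rightarrow> nat \<Rightarrow> real"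
  where "entry x k = (if k = 0 then 0 else x $ (k - 1))"

lemma row_observer_C: "x \<in> carrier_vec d \<Longrightarrow> row observer_C 0 \<bullet> x = entry x d"
proof -
  assume x: "x \<in> carrier_vec d"
  have "row observer_C 0 \<bullet> x = (\<Sum>j\<in>{0..<d}. if j = d - 1 \<and> d > 0 then x $ j else 0)"
    using x unfolding scalar_prod_def by (intro sum.cong) (auto simp: observer_C_def)
  also have "\<dots> = entry x d" by (cases d) (auto simp: entry_def)
  finally show ?thesis .
qed

lemma observer_A_mult:
  assumes x: "x \<in> carrier_vec d" and i: "i < d"
  shows "(observer_A *\<^sub>v x) $ i = entry x i + a i * entry x d"
proof -
  have r: "(observer_A *\<^sub>v x) $ i = row observer_A i \<bullet> x"
    using i by (simp add: observer_A_def)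
  have "(observer_A *\<^sub>v x) $ i =
      (\<Sum>j\<in>{0..<d}. (if i = Suc j then x $ j else 0) + (if Suc j = d then a i * x $ j else 0))"
    using x i unfolding r scalar_prod_def
    by (intro sum.cong) (auto simp: observer_A_def)
  also have "\<dots> = (\<Sum>j\<in>{0..<d}. if j = i - 1 \<and> 0 < i then x $ j else 0)
      + (\<Sum>j\<in>{0..<d}. if j = d - 1 then a i * x $ j else 0)"
    unfolding sum.distrib using i by (intro arg_cong2[of _ _ _ _ "(+)"] sum.cong) auto
  also have "\<dots> = entry x i + a i * entry x d"
    using i by (cases i) (auto simp: entry_def)
  finally show ?thesis .
qed

lemma observer_carrier:
  "observer_A \<in> carrier_mat d d" "observer_B \<in> carrier_mat d 1" "observer_C \<in> carrier_mat 1 d" "observer_D \<in> carrier_mat 1 1"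
  by (auto simp: observer_A_def observer_B_def observer_C_def observer_D_def)

lemma observer_form_rep: "ss_rep 2 \<B> d observer_A observer_B observer_C observer_D"
  unfolding rep_iff
proof (intro conjI allI observer_carrier)
  fix u y
  have D: "observer_D $$ (0, 0) = b d" by (simp add: observer_D_def)
  have next_state: "(observer_A *\<^sub>v x + c \<cdot>\<^sub>v col observer_B 0) $ k
      = entry x k + a k * (entry x d + b d * c) + b k * c" if "k < d" "x \<in> carrier_vec d" for x c k
    using observer_A_mult[OF that(2,1)] that observer_carrier(2) by (simp add: observer_B_def algebra_simps)
  show "signals \<B> u y \<longleftrightarrow> (\<exists>x. (\<forall>t. x t \<in> carrier_vec d) \<and>
      (\<forall>t. x (t + 1) = observer_A *\<^sub>v x t + u t \<cdot>\<^sub>v col observer_B 0) \<and>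
      (\<forall>t. y t = row observer_C 0 \<bullet> x t + observer_D $$ (0, 0) * u t))" (is "_ \<longleftrightarrow> ?R")
    unfolding signals_iff_arx arx_iff_observer_form
  proof (intro iffI; elim exE conjE)
    fix z assume z: "\<forall>t. z t 0 = 0"
      "\<forall>t. \<forall>k<d. z (t + 1) (Suc k) = z t k + a k * y t + b k * u t"
      "\<forall>t. y t = z t d + b d * u t"
    define x where "x t = vec d (\<lambda>k. z t (Suc k))" for t
    have x: "x t \<in> carrier_vec d" for t by (simp add: x_def)
    have e: "entry (x t) k = z t k" if "k \<le> d" for t k
      using that z(1) by (cases k) (auto simp: entry_def x_def)
    have "y t = row observer_C 0 \<bullet> x t + observer_D $$ (0, 0) * u t" for t
      using z(3)[rule_format, of t] by (simp add: row_observer_C[OF x] e D)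
    moreover have "x (t + 1) = observer_A *\<^sub>v x t + u t \<cdot>\<^sub>v col observer_B 0" for t
    proof (rule eq_vecI)
      fix k assume "k < dim_vec (observer_A *\<^sub>v x t + u t \<cdot>\<^sub>v col observer_B 0)"
      then have k: "k < d" using observer_carrier(2) by simp
      have "x (t + 1) $ k = z (t + 1) (Suc k)" using k by (simp only: x_def index_vec)
      also have "\<dots> = z t k + a k * y t + b k * u t" using z(2) k by blast
      also have "\<dots> = (observer_A *\<^sub>v x t + u t \<cdot>\<^sub>v col observer_B 0) $ k"
        unfolding next_state[OF k x] using k z(3)[rule_format, of t] by (simp add: e)
      finally show "x (t + 1) $ k = (observer_A *\<^sub>v x t + u t \<cdot>\<^sub>v col observer_B 0) $ k" .
    qed (use observer_carrier(2) in \<open>simp add: x_def\<close>)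
    ultimately show ?R using x by blast
  next
    fix x assume x: "\<forall>t. x t \<in> carrier_vec d"
      "\<forall>t. x (t + 1) = observer_A *\<^sub>v x t + u t \<cdot>\<^sub>v col observer_B 0"
      "\<forall>t. y t = row observer_C 0 \<bullet> x t + observer_D $$ (0, 0) * u t"
    have out: "y t = entry (x t) d + b d * u t" for t
      using x(1,3) by (simp only: row_observer_C D)
    have step: "entry (x (t + 1)) (Suc k) = entry (x t) k + a k * y t + b k * u t" if "k < d" for t k
    proof -
      have "entry (x (t + 1)) (Suc k) = x (t + 1) $ k" by (simp add: entry_def)
      also have "\<dots> = entry (x t) k + a k * y t + b k * u t"
        unfolding x(2)[rule_format] out using next_state that x(1) by blast
      finally show ?thesis .
    qed
    have "entry (x t) 0 = 0" for t by (simp add: entry_def)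
    with out step show "\<exists>z. (\<forall>t. z t 0 = 0) \<and>
        (\<forall>t k. k < d \<longrightarrow> z (t + 1) (Suc k) = z t k + a k * y t + b k * u t) \<and>
        (\<forall>t. y t = z t d + b d * u t)"
      by (intro exI[of _ "\<lambda>t. entry (x t)"] conjI allI impI) assumption+
  qed
qed

section \<open>McMillan degree and lag\<close>

lemma mcmillan_degree_eq: "mcmillan_degree 2 \<B> = d"
  unfolding mcmillan_degree_def
proof (rule Least_equality)
  show "\<exists>A B C D. ss_rep 2 \<B> d A B C D" using observer_form_rep by blast
qed (use order_le in blast)

text \<open>The matrix is square, so a trivial kernel suffices. A kernel vector, taken as initial
  state, yields a zero-input response whose first \<open>d\<close> outputs vanish, hence a zero
  output. The output is the last state entry, and with it 0 each step merely moves entry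
  \<open>k\<close> to \<open>k + 1\<close>, so every entry would appear at the output and is
  0.\<close>

lemma observer_form_rank: "vec_space.rank d (obs_mat d observer_A observer_C) = d"
proof -
  note O = obs_mat_carrier[OF observer_carrier(1,3), of d]
  have "v = 0\<^sub>v d" if v: "v \<in> carrier_vec d" and 0: "obs_mat d observer_A observer_C *\<^sub>v v = 0\<^sub>v d" for v
  proof -
    define x where "x t = observer_A ^\<^sub>m t *\<^sub>v v" for t
    have x: "x t \<in> carrier_vec d" for t
      unfolding x_def using v observer_carrier(1) by (intro mult_mat_vec_carrier[of _ d d]) auto
    have "arx d a b (\<lambda>_. 0) (\<lambda>t. row observer_C 0 \<bullet> x t)"
      using rep_zero_input[OF observer_form_rep v] unfolding signals_iff_arx x_def .
    moreover have "arx d a b (\<lambda>_. 0) (\<lambda>_. 0)" by (simp add: arx_def)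
    moreover have "row observer_C 0 \<bullet> x s = 0" if "s < d" for s
      using obs_mat_mult_vec[OF observer_carrier(1,3) v that] 0 that by (simp add: x_def)
    ultimately have "row observer_C 0 \<bullet> x t = 0" for t
      using arx_unique[of d a b _ _ "\<lambda>_. 0"] by blast
    then have last: "entry (x t) d = 0" for t using row_observer_C[OF x] by simp
    have shift: "entry (x (Suc t)) (Suc k) = entry (x t) k" if "k < d" for t k
      using observer_A_mult[OF x that, of t] pow_mat_mult_vec_Suc[OF observer_carrier(1) v, of t] last[of t]
      by (simp add: x_def entry_def del: pow_mat.simps)
    have "entry (x t) (d - j) = 0" if "j \<le> d" for t j
      using that
    proof (induction j arbitrary: t)
      case 0
      show ?case using last by simp
    next
      case (Suc j)
      then show ?case using shift[of "d - Suc j" t] by (simp add: Suc_diff_Suc)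
    qed
    then have "entry (x 0) k = 0" if "k \<le> d" for k
      using that by (metis diff_diff_cancel diff_le_self)
    moreover have "x 0 = v" using v observer_carrier(1) by (simp add: x_def)
    ultimately have "v $ k = 0" if "k < d" for k
      using that by (metis Suc_leI diff_Suc_1 entry_def nat.distinct(1))
    then show ?thesis using v by (intro eq_vecI) auto
  qed
  then have "det (obs_mat d observer_A observer_C) \<noteq> 0"
    using det_0_iff_vec_prod_zero_field[OF O] by blast
  then show ?thesis using vec_space.det_rank_iff[OF O] by simp
qed

text \<open>With a single output, \<open>L\<close> blocks are \<open>L\<close> rows, so no minimal
  representation reaches rank \<open>d\<close> before \<open>L = d\<close>; the observer form
  reaches it there.\<close>

lemma lag_eq: "lag 2 \<B> = d"
  unfolding lag_def mcmillan_degree_eq output_card mult_1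
proof (rule Least_equality)
  show "\<exists>A B C D. ss_rep 2 \<B> d A B C D \<and> vec_space.rank d (obs_mat d A C) = d"
    using observer_form_rep observer_form_rank by blast
next
  fix L assume "\<exists>A B C D. ss_rep 2 \<B> d A B C D \<and> vec_space.rank L (obs_mat L A C) = d"
  then obtain A B C D where "ss_rep 2 \<B> d A B C D" and rank: "vec_space.rank L (obs_mat L A C) = d"
    by blast
  then have "A \<in> carrier_mat d d" "C \<in> carrier_mat 1 d" unfolding rep_iff by blast+
  from rank_le_nr[OF obs_mat_carrier[OF this, of L]] rank show "d \<le> L" by simp
qed

text \<open>\<open>h\<close> lists the Markov parameters, feedthrough first. The pulse is delayed to
  time \<open>d\<close> so that the recurrence sees a full window of zero past outputs.\<close>

lemma rep_impulse:
  assumes rep: "ss_rep 2 \<B> n A B C D"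
  defines "h \<equiv> \<lambda>k. if k = 0 then D $$ (0, 0) else (C * A ^\<^sub>m (k - 1) * B) $$ (0, 0)"
  shows "signals \<B> (\<lambda>t. if t = d then 1 else 0) (\<lambda>t. if t < d then 0 else h (t - d))"
proof -
  have c: "A \<in> carrier_mat n n" "B \<in> carrier_mat n 1" "C \<in> carrier_mat 1 n"
    using rep unfolding rep_iff by blast+
  let ?u = "\<lambda>t. if t = d then 1 else 0 :: real"
  \<comment> \<open>The state rests at 0 through time \<open>d\<close>; the pulse enters it one step
    later as the column of \<open>B\<close>, and from then on it evolves without input.\<close>
  define x where "x t = (if t \<le> d then 0\<^sub>v n else A ^\<^sub>m (t - d - 1) *\<^sub>v col B 0)" for t
  have col: "col B 0 \<in> carrier_vec n" using c by auto
  have x: "x t \<in> carrier_vec n" for t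
    unfolding x_def using c col by (auto intro!: mult_mat_vec_carrier[of _ n n])
  have "x (t + 1) = A *\<^sub>v x t + ?u t \<cdot>\<^sub>v col B 0" for t
  proof -
    consider "t < d" | "t = d" | "d < t" by linarith
    then show ?thesis
    proof cases
      case 1
      with c show ?thesis by (intro eq_vecI) (auto simp: x_def)
    next
      case 2
      then have "x (t + 1) = col B 0" using c col by (simp add: x_def)
      then show ?thesis using 2 c by (intro eq_vecI) (auto simp: x_def)
    next
      case 3
      then have "x (t + 1) = A ^\<^sub>m Suc (t - d - 1) *\<^sub>v col B 0"
        by (simp add: x_def Suc_diff_Suc del: pow_mat.simps)
      also have "\<dots> = A *\<^sub>v x t"
        unfolding pow_mat_mult_vec_Suc[OF c(1) col] using 3 by (simp add: x_def)
      finally show ?thesis using 3 c by (intro eq_vecI) auto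
    qed
  qed
  moreover have "(if t < d then 0 else h (t - d)) = row C 0 \<bullet> x t + D $$ (0, 0) * ?u t" for t
  proof (cases "t \<le> d")
    case True
    then show ?thesis using c by (auto simp: x_def h_def)
  next
    case False
    then show ?thesis
      using row_mult_mult_col[OF c] by (simp add: x_def h_def)
  qed
  ultimately show ?thesis using rep x unfolding rep_iff by blast
qed

text \<open>The relative degree is the index of the first nonzero Markov parameter, which
  \<open>arx_impulse\<close> reads off the coefficients \<open>b\<close> alone. Hence the value is
  common to all representations.\<close>

lemma ss_relative_degree_eq:
  assumes rep: "ss_rep 2 \<B> n A B C D"
    and \<delta>: "\<delta> \<le> d" "b \<delta> \<noteq> 0" "\<And>i. \<delta> < i \<Longrightarrow> i \<le> d \<Longrightarrow> b i = 0"
  shows "ss_relative_degree A B C D = enat (d - \<delta>)"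
proof -
  define h where "h k = (if k = 0 then D $$ (0, 0) else (C * A ^\<^sub>m (k - 1) * B) $$ (0, 0))" for k
  note arx = rep_impulse[OF rep, folded h_def, unfolded signals_iff_arx]
  note h = arx_impulse[OF arx \<delta>]
  have c: "A \<in> carrier_mat n n" "B \<in> carrier_mat n 1" "C \<in> carrier_mat 1 n" "D \<in> carrier_mat 1 1"
    using rep unfolding rep_iff by blast+
  have zero_iff: "M = 0\<^sub>m 1 1 \<longleftrightarrow> M $$ (0, 0) = 0" if "M \<in> carrier_mat 1 1" for M :: "real mat"
    using that by (auto intro!: eq_matI)
  have D: "D = 0\<^sub>m 1 1 \<longleftrightarrow> h 0 = 0"
    using zero_iff[OF c(4)] by (simp add: h_def)
  have CAB: "C * A ^\<^sub>m k * B = 0\<^sub>m 1 1 \<longleftrightarrow> h (Suc k) = 0" for k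
    using c by (subst zero_iff) (auto simp: h_def)
  show ?thesis
  proof (cases "d - \<delta>")
    case 0
    with h(1) D show ?thesis by (simp add: ss_relative_degree_def zero_enat_def)
  next
    case (Suc r)
    \<comment> \<open>\<open>h (Suc k)\<close> belongs to the power \<open>k\<close> of
      \<open>A\<close>, so the index of the first nonzero value of \<open>h\<close> is exactly the
      \<open>r\<close> of the definition.\<close>
    have "(THE r. r \<ge> 1 \<and> (\<forall>k<r - 1. h (Suc k) = 0) \<and> h (Suc (r - 1)) \<noteq> 0) = Suc r"
    proof (rule the_equality)
      fix s assume s: "s \<ge> 1 \<and> (\<forall>k<s - 1. h (Suc k) = 0) \<and> h (Suc (s - 1)) \<noteq> 0"
      then have "\<not> s < Suc r" using h(2)[of s] Suc by auto
      moreover have "\<not> Suc r < s" using s h(1) Suc by auto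
      ultimately show "s = Suc r" by simp
    qed (use h Suc in auto)
    moreover have "D = 0\<^sub>m 1 1" using h(2)[of 0] Suc D by simp
    moreover have "\<not> (\<forall>k. h (Suc k) = 0)" using h(1) Suc by auto
    ultimately show ?thesis unfolding ss_relative_degree_def CAB using Suc by simp
  qed
qed

lemma relative_degree_eq:
  assumes "\<delta> \<le> d" "b \<delta> \<noteq> 0" "\<And>i. \<delta> < i \<Longrightarrow> i \<le> d \<Longrightarrow> b i = 0"
  shows "relative_degree \<B> = enat (d - \<delta>)"
  unfolding relative_degree_def
proof (rule the_equality)
  show "\<exists>n A B C D. ss_rep 2 \<B> n A B C D \<and> enat (d - \<delta>) = ss_relative_degree A B C D"
    using observer_form_rep ss_relative_degree_eq[OF observer_form_rep assms] by metis
next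
  fix r assume "\<exists>n A B C D. ss_rep 2 \<B> n A B C D \<and> r = ss_relative_degree A B C D"
  then show "r = enat (d - \<delta>)" using ss_relative_degree_eq[OF _ assms] by blast
qed

end

lemma siso_arx_exists:
  assumes "\<B> \<in> \<L> 2" "input_card 2 \<B> = 1" "output_card 2 \<B> = 1" "io_partitioned 2 \<B>"
  shows "\<exists>d a b. siso_arx \<B> d a b"
proof -
  interpret siso_behavior "signals \<B>" using assms(1,2,4) by (rule siso_behavior_signals)
  from arx_representation obtain d a b where "\<forall>u y. signals \<B> u y \<longleftrightarrow> arx d a b u y"
    "\<forall>y\<^sub>0. \<exists>y. signals \<B> (\<lambda>_. 0) y \<and> (\<forall>s<d. y s = y\<^sub>0 s)" by blast
  with assms have "siso_arx \<B> d a b" by unfold_locales blast+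
  then show ?thesis by blast
qed

section \<open>Rows of the data matrices\<close>

text \<open>\<open>V\<close> stands for membership in a subspace, \<open>U\<close> and
  \<open>Y\<close> for the input and output rows. In the recurrence for \<open>Y (p + d)\<close> the
  last input row with nonzero coefficient is \<open>U (p + \<delta>)\<close>. So output rows stay in
  \<open>V\<close> until that row is \<open>U \<kappa>\<close>, and then it is the only term outside
  \<open>V\<close>.\<close>

lemma first_exit_delay:
  fixes V :: "(nat \<Rightarrow> real) \<Rightarrow> bool" and U Y :: "nat \<Rightarrow> nat \<Rightarrow> real"
  assumes zero: "V (\<lambda>_. 0)" and add: "\<And>f g. V f \<Longrightarrow> V g \<Longrightarrow> V (\<lambda>j. f j + g j)"
    and scale: "\<And>c f. V f \<Longrightarrow> V (\<lambda>j. c * f j)"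
    and base: "\<And>i. i < d \<Longrightarrow> V (U i) \<and> V (Y i)"
    and rec: "\<And>i j. Y (i + d) j = (\<Sum>k<d. a k * Y (i + k) j) + (\<Sum>k\<le>d. b k * U (i + k) j)"
    and exit: "i\<^sub>0 < L" "\<not> V (Y i\<^sub>0)"
  obtains \<delta> \<kappa> where "\<delta> \<le> d" "b \<delta> \<noteq> 0" "\<And>i. \<delta> < i \<Longrightarrow> i \<le> d \<Longrightarrow> b i = 0"
    "\<kappa> + (d - \<delta>) < L" "\<not> V (U \<kappa>)" "\<And>i. i < \<kappa> \<Longrightarrow> V (U i)"
    "\<not> V (Y (\<kappa> + (d - \<delta>)))" "\<And>i. i < \<kappa> + (d - \<delta>) \<Longrightarrow> V (Y i)"
proof -
  \<comment> \<open>Terms with zero coefficient are exempt, so input rows beyond index \<delta> of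
    the window may lie outside \<open>V\<close>.\<close>
  have sums: "V (\<lambda>j. \<Sum>k\<in>I. c k * f k j)" if "finite I" "\<And>k. k \<in> I \<Longrightarrow> c k \<noteq> 0 \<Longrightarrow> V (f k)"
    for I :: "nat set" and c :: "nat \<Rightarrow> real" and f
    using that
  proof (induction I rule: finite_induct)
    case (insert k I)
    have "V (\<lambda>j. c k * f k j)"
      using insert.prems[of k] zero by (cases "c k = 0") (auto intro: scale)
    with insert show ?case by (simp add: add)
  qed (simp add: zero)
  have step: "V (Y i)"
    if "\<And>k. d \<le> i \<Longrightarrow> k \<le> d \<Longrightarrow> b k \<noteq> 0 \<Longrightarrow> V (U (i - d + k))" "\<And>k. k < i \<Longrightarrow> V (Y k)" for i
  proof (cases "i < d")
    case False
    then have i: "i = i - d + d" by simp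
    have "V (\<lambda>j. (\<Sum>k<d. a k * Y (i - d + k) j) + (\<Sum>k\<le>d. b k * U (i - d + k) j))"
      using False that by (intro add sums) auto
    also have "(\<lambda>j. (\<Sum>k<d. a k * Y (i - d + k) j) + (\<Sum>k\<le>d. b k * U (i - d + k) j)) = Y i"
      by (rule sym, subst i, rule ext, rule rec)
    finally show ?thesis .
  qed (simp add: base)
  \<comment> \<open>The first output row outside \<open>V\<close> must be caused by an input row
    outside \<open>V\<close> with nonzero coefficient; this is why both \<delta> and \<kappa>
    exist.\<close>
  obtain i\<^sub>1 where i1: "\<not> V (Y i\<^sub>1)" "\<And>k. k < i\<^sub>1 \<Longrightarrow> V (Y k)"
    using exists_least_iff[of "\<lambda>i. \<not> V (Y i)"] exit(2) by blast
  then obtain k\<^sub>1 where k1: "k\<^sub>1 \<le> d" "b k\<^sub>1 \<noteq> 0" "\<not> V (U (i\<^sub>1 - d + k\<^sub>1))"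
    using step[of i\<^sub>1] by blast
  define \<delta> where "\<delta> = Max {k. k \<le> d \<and> b k \<noteq> 0}"
  have "\<delta> \<in> {k. k \<le> d \<and> b k \<noteq> 0}"
    unfolding \<delta>_def using k1 by (intro Max_in) auto
  then have \<delta>: "\<delta> \<le> d" "b \<delta> \<noteq> 0" by auto
  have \<delta>_max: "b i = 0" if "\<delta> < i" "i \<le> d" for i
  proof (rule ccontr)
    assume "b i \<noteq> 0"
    with that have "i \<le> \<delta>" unfolding \<delta>_def by (intro Max_ge) auto
    with that show False by simp
  qed
  obtain \<kappa> where \<kappa>: "\<not> V (U \<kappa>)" "\<And>i. i < \<kappa> \<Longrightarrow> V (U i)"
    using exists_least_iff[of "\<lambda>i. \<not> V (U i)"] k1(3) by blast
  have before: "V (Y i)" if "i < \<kappa> + (d - \<delta>)" for i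
    using that
  proof (induction i rule: less_induct)
    case (less i)
    show ?case
    proof (rule step)
      fix k assume k: "d \<le> i" "k \<le> d" "b k \<noteq> 0"
      then have "k \<le> \<delta>" using \<delta>_max by (meson not_less)
      with k less.prems \<delta>(1) show "V (U (i - d + k))" by (intro \<kappa>(2)) simp
    qed (use less in simp)
  qed
  \<comment> \<open>Hence \<open>\<kappa> - \<delta>\<close> is a genuine subtraction, and the
    recurrence started there has \<open>U \<kappa>\<close> as its term of index \<delta>.\<close>
  have "d \<le> \<kappa>" using \<kappa>(1) base not_less by blast
  define p where "p = \<kappa> - \<delta>"
  have p: "p + \<delta> = \<kappa>" "p + d = \<kappa> + (d - \<delta>)" using \<delta> \<open>d \<le> \<kappa>\<close> by (auto simp: p_def)
  have at: "\<not> V (Y (p + d))"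
  proof
    assume Y: "V (Y (p + d))"
    \<comment> \<open>The recurrence at \<open>p\<close> solved for \<open>U \<kappa>\<close>: if
      the output row lay in \<open>V\<close>, so would \<open>U \<kappa>\<close>.\<close>
    let ?f = "\<lambda>j. 1 / b \<delta> * (Y (p + d) j + -1 * ((\<Sum>k<d. a k * Y (p + k) j)
      + (\<Sum>k<\<delta>. b k * U (p + k) j)))"
    have "V ?f"
      using p by (intro scale add Y sums before \<kappa>(2)) auto
    moreover have "?f j = U \<kappa> j" for j
    proof -
      have "(\<Sum>k\<le>d. b k * U (p + k) j) = (\<Sum>k\<le>\<delta>. b k * U (p + k) j)"
        using \<delta>_max \<delta>(1) by (intro sum.mono_neutral_right) auto
      also have "\<dots> = (\<Sum>k<\<delta>. b k * U (p + k) j) + b \<delta> * U \<kappa> j"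
        by (simp add: lessThan_Suc_atMost[symmetric] p(1))
      finally show ?thesis using rec[of p j] \<delta>(2) by simp
    qed
    ultimately show False using \<kappa>(1) by simp
  qed
  have "\<kappa> + (d - \<delta>) < L"
    using before[of i\<^sub>0] exit by linarith
  with that[of \<delta> \<kappa>] \<delta> \<delta>_max \<kappa> before at p(2) show thesis by simp
qed

section \<open>The subspace spanned by the data rows\<close>

lemma row_in_mat_image_transpose:
  assumes "i < dim_row N"
  shows "row N i \<in> mat_image N\<^sup>T"
proof -
  have "N\<^sup>T *\<^sub>v unit_vec (dim_row N) i = row N i"
    using assms by (intro eq_vecI) (auto simp: scalar_prod_right_unit)
  then show ?thesis by (auto simp: mat_image_def intro!: image_eqI[of _ _ "unit_vec (dim_row N) i"])
qed

lemma mat_image_add: "v \<in> mat_image N \<Longrightarrow> w \<in> mat_image N \<Longrightarrow> v + w \<in> mat_image N"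
  unfolding mat_image_def
  by (auto simp: mult_add_distrib_mat_vec[of N "dim_row N" "dim_col N", symmetric])

lemma mat_image_smult: "v \<in> mat_image N \<Longrightarrow> c \<cdot>\<^sub>v v \<in> mat_image N"
  unfolding mat_image_def
  by (auto simp: mult_mat_vec[of N "dim_row N" "dim_col N", symmetric])

lemma mat_image_zero: "0\<^sub>v (dim_row N) \<in> mat_image N"
  unfolding mat_image_def
  by (rule image_eqI[of _ _ "0\<^sub>v (dim_col N)"]) (auto intro!: eq_vecI)

lemma dim_hankel [simp]: "dim_row (hankel T L f) = L" "dim_col (hankel T L f) = T + 2 - L"
  by (simp_all add: hankel_def)

lemma row_hankel: "i < L \<Longrightarrow> row (hankel T L f) i = vec (T + 2 - L) (\<lambda>j. f (i + j))"
  by (auto simp: hankel_def)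

text \<open>These rows are among those stacked in the matrix whose row space is
  \<open>data_image\<close>: input row \<open>i\<close> at position \<open>i\<close>, output row
  \<open>i\<close> at position \<open>?l + i\<close>.\<close>

lemma hankel_rows_in_data_image:
  assumes "i < lag 2 \<B>" "lag 2 \<B> \<le> L"
  shows "row (hankel T L u) i \<in> data_image \<B> T L u y" "row (hankel T L y) i \<in> data_image \<B> T L u y"
proof -
  let ?l = "lag 2 \<B>" and ?n = "T + 2 - L"
  let ?U = "row_block (hankel T L u) 1 ?l" and ?Y = "row_block (hankel T L y) 1 ?l"
  have c: "?U \<in> carrier_mat ?l ?n" "?Y \<in> carrier_mat ?l ?n" by (auto simp: row_block_def)
  then have d: "dim_row (?U @\<^sub>r ?Y) = ?l + ?l" "dim_col (?U @\<^sub>r ?Y) = ?n"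
    using carrier_append_rows[OF c] by blast+
  have "row (?U @\<^sub>r ?Y) i = row (hankel T L u) i"
    using assms c d by (intro eq_vecI) (auto simp: append_rows_def, auto simp: row_block_def)
  moreover have "row (?U @\<^sub>r ?Y) (?l + i) = row (hankel T L y) i"
    using assms c d by (intro eq_vecI) (auto simp: append_rows_def, auto simp: row_block_def)
  ultimately show "row (hankel T L u) i \<in> data_image \<B> T L u y" "row (hankel T L y) i \<in> data_image \<B> T L u y"
    using row_in_mat_image_transpose[of i "?U @\<^sub>r ?Y"]
      row_in_mat_image_transpose[of "?l + i" "?U @\<^sub>r ?Y"] assms d
    by (simp_all add: data_image_def)
qed

lemma rows_outside_first_exit:
  assumes "\<kappa> < dim_row N" "row N \<kappa> \<notin> M" "\<And>i. i < \<kappa> \<Longrightarrow> row N i \<in> M"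
  shows "rows_outside N M \<noteq> {}" "Min (rows_outside N M) = \<kappa> + 1"
proof -
  have in_set: "\<kappa> + 1 \<in> rows_outside N M" using assms by (simp add: rows_outside_def)
  then show "rows_outside N M \<noteq> {}" by blast
  show "Min (rows_outside N M) = \<kappa> + 1"
  proof (rule Min_eqI)
    show "finite (rows_outside N M)"
      by (rule finite_subset[of _ "{..dim_row N}"]) (auto simp: rows_outside_def)
    fix i assume "i \<in> rows_outside N M"
    then have "1 \<le> i" "\<not> i - 1 < \<kappa>" using assms(3) by (auto simp: rows_outside_def)
    then show "\<kappa> + 1 \<le> i" by simp
  qed (rule in_set)
qed

theorem theorem12:
  fixes \<B> :: behavior and u\<^sub>d y\<^sub>d :: "nat \<Rightarrow> real" and T L :: nat
  assumes "\<B> \<in> \<L> 2"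
    and "input_card 2 \<B> = 1" and "output_card 2 \<B> = 1"
    and "io_partitioned 2 \<B>"
    and "(\<lambda>t\<in>{0..T}. vec_of_list [u\<^sub>d t, y\<^sub>d t]) \<in> restrict_beh \<B> 0 T"
    and "L \<ge> lag 2 \<B> + mcmillan_degree 2 \<B> + 1" and "L \<le> T + 1"
    and "\<exists>i. 1 \<le> i \<and> i \<le> L \<and> row (hankel T L y\<^sub>d) (i - 1) \<notin> data_image \<B> T L u\<^sub>d y\<^sub>d"
  shows "let M = data_image \<B> T L u\<^sub>d y\<^sub>d;
             K\<^sub>u = rows_outside (hankel T L u\<^sub>d) M;
             K\<^sub>y = rows_outside (hankel T L y\<^sub>d) M
         in K\<^sub>u \<noteq> {} \<and> Min K\<^sub>u \<le> Min K\<^sub>y \<and> relative_degree \<B> = enat (Min K\<^sub>y - Min K\<^sub>u)"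
proof -
  obtain d a b where "siso_arx \<B> d a b" using siso_arx_exists assms(1-4) by blast
  then interpret siso_arx \<B> d a b .
  have "d \<le> L" using assms(6) lag_eq by simp
  define M where "M = data_image \<B> T L u\<^sub>d y\<^sub>d"
  define n where "n = T + 2 - L"
  define V where "V f \<longleftrightarrow> vec n f \<in> M" for f
  \<comment> \<open>The data extend to a trajectory on all times, so the recurrence holds without a
    bound on time. The Hankel entries themselves only read times up to \<open>T\<close>.\<close>
  obtain f where f: "f \<in> \<B>" "(\<lambda>t\<in>{0..T}. vec_of_list [u\<^sub>d t, y\<^sub>d t]) = restrict f {0..T}"
    using assms(5) unfolding restrict_beh_def by blast
  define u where "u t = f t $ 0" for t
  define y where "y t = f t $ 1" for t
  have "(\<lambda>t. pair_vec (u t) (y t)) = f"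
    unfolding u_def y_def using LTI f(1) by (intro ext pair_vec_eq) (auto simp: LTI_def)
  then have arx: "arx d a b u y" using f(1) by (simp add: signals_def flip: signals_iff_arx)
  have data: "u t = u\<^sub>d t" "y t = y\<^sub>d t" if "t \<le> T" for t
    using fun_cong[OF f(2), of t] that by (auto simp: u_def y_def dest: sym)
  have row_u: "row (hankel T L u\<^sub>d) i = vec n (\<lambda>j. u (i + j))"
    and row_y: "row (hankel T L y\<^sub>d) i = vec n (\<lambda>j. y (i + j))" if "i < L" for i
    using that assms(7) by (auto simp: row_hankel n_def data)
  obtain i\<^sub>0 where i0: "i\<^sub>0 < L" "\<not> V (\<lambda>j. y (i\<^sub>0 + j))"
  proof -
    from assms(8) obtain i where "1 \<le> i" "i \<le> L" "row (hankel T L y\<^sub>d) (i - 1) \<notin> M"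
      unfolding M_def by blast
    then show thesis using that[of "i - 1"] row_y[of "i - 1"] by (simp add: V_def)
  qed
  have M_dim: "dim_row ((row_block (hankel T L u\<^sub>d) 1 l @\<^sub>r row_block (hankel T L y\<^sub>d) 1 l)\<^sup>T) = n" for l
    by (simp add: append_rows_def row_block_def n_def)
  have zero: "V (\<lambda>_. 0)"
  proof -
    have "vec n (\<lambda>_. 0) = (0\<^sub>v n :: real vec)" by auto
    with mat_image_zero[of "(row_block (hankel T L u\<^sub>d) 1 (lag 2 \<B>) @\<^sub>r row_block (hankel T L y\<^sub>d) 1 (lag 2 \<B>))\<^sup>T"]
    show ?thesis unfolding V_def M_def data_image_def M_dim by simp
  qed
  have add: "V (\<lambda>j. g j + h j)" if "V g" "V h" for g h
  proof -
    have "vec n (\<lambda>j. g j + h j) = vec n g + vec n h" by auto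
    with that mat_image_add show ?thesis unfolding V_def M_def data_image_def by metis
  qed
  have scale: "V (\<lambda>j. c * g j)" if "V g" for c g
  proof -
    have "vec n (\<lambda>j. c * g j) = c \<cdot>\<^sub>v vec n g" by auto
    with that mat_image_smult show ?thesis unfolding V_def M_def data_image_def by metis
  qed
  \<comment> \<open>Here the lag enters: it equals the order \<open>d\<close>, so the rows spanning
    \<open>M\<close> include all the initial rows that the recurrence needs.\<close>
  have base: "V (\<lambda>j. u (i + j)) \<and> V (\<lambda>j. y (i + j))" if "i < d" for i
    using hankel_rows_in_data_image[of i \<B> L, where u = u\<^sub>d and y = y\<^sub>d and T = T] that \<open>d \<le> L\<close> row_u[of i] row_y[of i]
    by (simp add: lag_eq V_def M_def)
  have rec: "y (i + d + j) = (\<Sum>k<d. a k * y (i + k + j)) + (\<Sum>k\<le>d. b k * u (i + k + j))" for i j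
    using arx[unfolded arx_def, rule_format, of "i + j"] by (simp only: ac_simps)
  obtain \<delta> \<kappa> where \<delta>: "\<delta> \<le> d" "b \<delta> \<noteq> 0" "\<And>i. \<delta> < i \<Longrightarrow> i \<le> d \<Longrightarrow> b i = 0"
    and \<kappa>: "\<kappa> + (d - \<delta>) < L" "\<not> V (\<lambda>j. u (\<kappa> + j))" "\<And>i. i < \<kappa> \<Longrightarrow> V (\<lambda>j. u (i + j))"
      "\<not> V (\<lambda>j. y (\<kappa> + (d - \<delta>) + j))" "\<And>i. i < \<kappa> + (d - \<delta>) \<Longrightarrow> V (\<lambda>j. y (i + j))"
    using first_exit_delay[of V d "\<lambda>i j. u (i + j)" "\<lambda>i j. y (i + j)" a b i\<^sub>0 L,
        OF zero add scale base rec i0] by blast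
  \<comment> \<open>Numbering rows from 1 adds 1 to both first exits; the offsets cancel in the
    difference, which leaves \<open>d - \<delta>\<close>.\<close>
  have Ku: "rows_outside (hankel T L u\<^sub>d) M \<noteq> {}" "Min (rows_outside (hankel T L u\<^sub>d) M) = \<kappa> + 1"
    using rows_outside_first_exit[of \<kappa> "hankel T L u\<^sub>d" M] \<kappa>(1-3) by (simp_all add: row_u V_def)
  have Ky: "Min (rows_outside (hankel T L y\<^sub>d) M) = \<kappa> + (d - \<delta>) + 1"
    using rows_outside_first_exit(2)[of "\<kappa> + (d - \<delta>)" "hankel T L y\<^sub>d" M] \<kappa>(1,4,5)
    by (simp add: row_y V_def)
  show ?thesis
    unfolding Let_def M_def[symmetric] using Ku Ky relative_degree_eq[OF \<delta>] by simp
qed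

end
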